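(* Let $N\ge 1$ be an integer and let $P_n(x)$, $n=0,1,\dots,N$, be the Sturmian sequence of polynomials on the linear grid $x_s=s$, $s=0,1,\dots,N$. Then $$P_n(x)=H_n(x;\alpha,\beta,N),\qquad n=0,1,\dots,N,\qquad\text{with }\alpha=\beta=-N-1,$$ where $H_n(x;\alpha,\beta,N)$ are the monic Hahn polynomials.
   Context: Sturmian sequence on a grid: given distinct real numbers $x_0,\dots,x_N$, put $P_{N+1}(x)=\prod_{s=0}^N(x-x_s)$ and $P_N(x)=(N+1)^{-1}P_{N+1}'(x)$. The Euclidean algorithm produces uniquely monic polynomials $P_{N-1},\dots,P_0=1$ ($\deg P_n=n$), real $b_n$ and $u_n>0$ with $P_{n+1}(x)=(x-b_n)P_n(x)-u_nP_{n-1}(x)$ for $n=1,\dots,N$, and $P_1(x)=x-b_0$. The polynomials $P_0,\dots,P_N$ form the Sturmian sequence. Monic Hahn polynomials: $$H_n(x;\alpha,\beta,N)=\kappa_n\;{}_3F_2\left({-n,\,-x,\,n+\alpha+\beta+1\atop -N,\ \alpha+1};1\right),\qquad \kappa_n=\frac{(-N)_n(\alpha+1)_n}{(n+\alpha+\beta+1)_n},$$ where $(y)_n=y(y+1)\cdots(y+n-1)$, and for $0\le n\le N$ the ${}_3F_2$ series is the finite sum of its terms with index $k=0,\dots,n$. *)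

theory Defs
  imports Complex_Main "HOL-Computational_Algebra.Polynomial"
begin

text \<open>
  The Euclidean algorithm on the grid \<open>x 0, \<dots>, x N\<close>, listed by descending degree: entry \<open>k\<close> is
  \<open>P\<^sub>N\<^sub>+\<^sub>1\<^sub>-\<^sub>k\<close>. The remainder of \<open>P\<^sub>n\<^sub>+\<^sub>1\<close> by \<open>P\<^sub>n\<close> is \<open>- u\<^sub>n P\<^sub>n\<^sub>-\<^sub>1\<close>, and dividing it by its leading
  coefficient \<open>- u\<^sub>n\<close> leaves the monic polynomial \<open>P\<^sub>n\<^sub>-\<^sub>1\<close>.
\<close>

fun sturmian_desc :: "nat \<Rightarrow> (nat \<Rightarrow> real) \<Rightarrow> nat \<Rightarrow> real poly" where
  "sturmian_desc N x 0 = (\<Prod>s\<le>N. [:- x s, 1:])"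
| "sturmian_desc N x (Suc 0) = smult (1 / (real N + 1)) (pderiv (\<Prod>s\<le>N. [:- x s, 1:]))"
| "sturmian_desc N x (Suc (Suc k)) =
     (let r = sturmian_desc N x k mod sturmian_desc N x (Suc k)
      in smult (inverse (lead_coeff r)) r)"

definition sturmian :: "nat \<Rightarrow> (nat \<Rightarrow> real) \<Rightarrow> nat \<Rightarrow> real poly" where
  "sturmian N x n = sturmian_desc N x (N + 1 - n)"

text \<open>
  The description of the sequence by its recurrence, satisfiable for distinct nodes; up to index
  \<open>N + 1\<close>, \<open>sturmian\<close> is the only sequence that can satisfy it.
\<close>

definition is_sturmian :: "nat \<Rightarrow> (nat \<Rightarrow> real) \<Rightarrow> (nat \<Rightarrow> real poly) \<Rightarrow> bool" where
  "is_sturmian N x P \<longleftrightarrow>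
     P (N + 1) = (\<Prod>s\<le>N. [:- x s, 1:]) \<and>
     P N = smult (1 / (real N + 1)) (pderiv (P (N + 1))) \<and>
     P 0 = 1 \<and>
     (\<forall>n\<le>N. degree (P n) = n \<and> lead_coeff (P n) = 1) \<and>
     (\<exists>b u. P 1 = [:- b 0, 1:] \<and>
        (\<forall>n\<in>{1..N}. u n > (0::real) \<and>
           P (n + 1) = [:- b n, 1:] * P n - smult (u n) (P (n - 1))))"

lemma is_sturmian_imp_eq_sturmian:
  assumes P: "is_sturmian N x P" and n: "n \<le> N + 1"
  shows "P n = sturmian N x n"
proof -
  from P obtain b u where
    top: "P (N + 1) = (\<Prod>s\<le>N. [:- x s, 1:])"
         "P N = smult (1 / (real N + 1)) (pderiv (P (N + 1)))" and
    deg: "\<And>n. n \<le> N \<Longrightarrow> degree (P n) = n" and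
    monic: "\<And>n. n \<le> N \<Longrightarrow> lead_coeff (P n) = 1" and
    u: "\<And>n. n \<in> {1..N} \<Longrightarrow> u n > (0::real)" and
    rec: "\<And>n. n \<in> {1..N} \<Longrightarrow>
            P (n + 1) = [:- b n, 1:] * P n - smult (u n) (P (n - 1))"
    unfolding is_sturmian_def by blast
  have "k \<le> N \<Longrightarrow> sturmian_desc N x k = P (N + 1 - k) \<and> sturmian_desc N x (Suc k) = P (N - k)" for k
  proof (induction k)
    case 0
    then show ?case using top by simp
  next
    case (Suc k)
    define n where "n = N - k"
    have n: "n \<in> {1..N}" "N + 1 - k = n + 1" "N - Suc k = n - 1" "N + 1 - Suc k = n"
      using Suc.prems by (auto simp: n_def)
    have IH: "sturmian_desc N x k = P (n + 1)" "sturmian_desc N x (Suc k) = P n"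
      using Suc n by (auto simp: n_def)
    have "degree (smult (- u n) (P (n - 1))) < degree (P n)"
      using deg[of n] deg[of "n - 1"] n(1) by (auto simp: degree_smult_eq)
    then have "(smult (- u n) (P (n - 1)) + [:- b n, 1:] * P n) mod P n = smult (- u n) (P (n - 1))"
      by (simp only: mod_mult_self1 mod_poly_less mod_mult_self2)
    moreover have "P (n + 1) = smult (- u n) (P (n - 1)) + [:- b n, 1:] * P n"
      using rec[OF n(1)] by (simp only: smult_minus_left diff_conv_add_uminus add.commute)
    ultimately have r: "P (n + 1) mod P n = smult (- u n) (P (n - 1))"
      by (simp only:)
    have "lead_coeff (P (n - 1)) = 1"
      using monic[of "n - 1"] n(1) by auto
    then have "sturmian_desc N x (Suc (Suc k)) = P (n - 1)"
      unfolding sturmian_desc.simps IH r Let_def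
      using u[OF n(1)] by simp
    with IH n show ?case by simp
  qed
  note * = this
  have "sturmian_desc N x k = P (N + 1 - k)" if "k \<le> N + 1" for k
    using *[of k] *[of N] that by (cases "k \<le> N") (auto simp: le_Suc_eq)
  from this[of "N + 1 - n"] n show ?thesis
    by (simp add: sturmian_def)
qed

definition hyp_3F2_partial ::
    "nat \<Rightarrow> real \<Rightarrow> real \<Rightarrow> real \<Rightarrow> real \<Rightarrow> real \<Rightarrow> real \<Rightarrow> real" where
  "hyp_3F2_partial n a1 a2 a3 b1 b2 z =
     (\<Sum>k=0..n. pochhammer a1 k * pochhammer a2 k * pochhammer a3 k /
                (pochhammer b1 k * pochhammer b2 k) * z ^ k / fact k)"

definition hahn :: "nat \<Rightarrow> real \<Rightarrow> real \<Rightarrow> nat \<Rightarrow> real \<Rightarrow> real" where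
  "hahn n \<alpha> \<beta> N x =
     pochhammer (- real N) n * pochhammer (\<alpha> + 1) n / pochhammer (real n + \<alpha> + \<beta> + 1) n *
     hyp_3F2_partial n (- real n) (- x) (real n + \<alpha> + \<beta> + 1) (- real N) (\<alpha> + 1) 1"

end

theory Submission
  imports Defs
begin

text \<open>
  A Sturmian sequence is pinned down by its two topmost members: a recurrence
  \<open>P\<^sub>n\<^sub>+\<^sub>1 = (x - b\<^sub>n) P\<^sub>n - u\<^sub>n P\<^sub>n\<^sub>-\<^sub>1\<close> with \<open>u\<^sub>n > 0\<close> and monic \<open>P\<^sub>n\<close> of degree \<open>n\<close> is a run of
  the Euclidean algorithm. So it suffices that the Hahn polynomials with \<open>\<alpha> = \<beta> = - N - 1\<close>
  satisfy such a recurrence for \<open>1 \<le> n \<le> N\<close> and that the sequence ends in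
  \<open>P\<^sub>N\<^sub>+\<^sub>1 = x (x - 1) \<dots> (x - N)\<close> and \<open>P\<^sub>N = P\<^sub>N\<^sub>+\<^sub>1' / (N + 1)\<close>; this is \<open>is_sturmian_hahn_poly\<close>.

  All polynomials are expanded in the falling factorials \<open>x (x - 1) \<dots> (x - k + 1) = (-1)\<^sup>k (-x)\<^sub>k\<close>,
  the basis in which the hypergeometric series is already written. For these parameters the
  Pochhammer symbols of \<open>H\<^sub>n\<close> are quotients of factorials, and with \<open>d = n - k\<close> and \<open>m = N - n\<close>
  its \<open>k\<close>-th coefficient is
  \<open>(-1)\<^sup>d \<cdot> n! / (k! d!) \<cdot> (d + m)!\<^sup>2 (2m + 1)! / (m!\<^sup>2 (2m + 1 + d)!)\<close>.
  Two facts about these coefficients carry the proof.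

  \<^item> Multiplication by \<open>x\<close> sends the \<open>k\<close>-th basis element to the next one plus \<open>k\<close> times itself. The
    recurrence thus becomes a relation between four neighbouring coefficients, which are rational
    multiples of each other (\<open>hahn_row_recurrence\<close>). It holds with
    \<open>b\<^sub>n = N / 2\<close>, in accordance with the symmetry of the grid under \<open>x \<mapsto> N - x\<close>, and with
    \<open>u\<^sub>n = n (N + 1 - n)\<^sup>2 (2N + 2 - n) / (4 (2N + 1 - 2n) (2N + 3 - 2n))\<close>. For \<open>n = N\<close> the factor \<open>m\<close> in
    the ratio between degrees \<open>n + 1\<close> and \<open>n\<close> vanishes, so that only the leading
    coefficient survives in degree \<open>N + 1\<close>: the recurrence then produces the grid polynomial.

  \<^item> For \<open>n = N\<close>, that is \<open>m = 0\<close>, the coefficient collapses to \<open>(-1)\<^sup>d N! / (k! (d + 1))\<close>. Up to the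
    factor \<open>N + 1\<close> these are the coefficients in the derivative of the falling factorial of length
    \<open>N + 1\<close>, given by \<open>d/dx = log (1 + \<Delta>) = \<Delta> - \<Delta>\<^sup>2 / 2 + \<dots>\<close> (\<open>pderiv_falling\<close>,
    \<open>hahn_poly_eq_pderiv\<close>).
\<close>

section \<open>Expansions in falling factorials\<close>

definition falling :: "nat \<Rightarrow> real poly" where
  "falling k = (\<Prod>i<k. [:- real i, 1:])"

lemma falling_0 [simp]: "falling 0 = 1"
  by (simp add: falling_def)

lemma falling_Suc: "falling (Suc k) = [:- real k, 1:] * falling k"
  by (simp add: falling_def mult.commute)

lemma degree_falling [simp]: "degree (falling k) = k"
  by (simp add: falling_def degree_prod_eq_sum_degree)

lemma lead_coeff_falling: "lead_coeff (falling k) = 1"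
  unfolding falling_def by (subst lead_coeff_prod) simp

lemma poly_falling: "poly (falling k) x = (-1) ^ k * pochhammer (- x) k"
  by (induction k) (simp_all add: falling_Suc pochhammer_Suc algebra_simps)

definition falling_sum :: "nat \<Rightarrow> (nat \<Rightarrow> real) \<Rightarrow> real poly" where
  "falling_sum M a = (\<Sum>k\<le>M. smult (a k) (falling k))"

lemma falling_sum_cong:
  assumes "\<And>k. k \<le> M \<Longrightarrow> a k = b k"
  shows "falling_sum M a = falling_sum M b"
  unfolding falling_sum_def using assms by (intro sum.cong) auto

lemma falling_sum_extend:
  assumes "M \<le> M'" and "\<And>k. M < k \<Longrightarrow> a k = 0"
  shows "falling_sum M' a = falling_sum M a"
  unfolding falling_sum_def using assms by (intro sum.mono_neutral_right) auto

lemma falling_sum_smult: "falling_sum M (\<lambda>k. c * a k) = smult c (falling_sum M a)"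
  unfolding falling_sum_def by (induction M) (simp_all add: smult_add_right)

lemma falling_sum_delta:
  assumes "n \<le> M"
  shows "falling_sum M (\<lambda>k. if k = n then 1 else 0) = falling n"
proof -
  have "falling_sum M (\<lambda>k. if k = n then 1 else 0) = (\<Sum>k\<le>M. if k = n then falling k else 0)"
    unfolding falling_sum_def by (intro sum.cong) auto
  with assms show ?thesis by simp
qed

lemma falling_sum_monic:
  assumes "a n = 1"
  shows "degree (falling_sum n a) = n" and "lead_coeff (falling_sum n a) = 1"
proof -
  define low where "low = (\<Sum>k<n. smult (a k) (falling k))"
  have sum: "falling_sum n a = falling n + low"
    using assms by (simp add: falling_sum_def low_def flip: lessThan_Suc_atMost)
  have low: "coeff low i = 0" if "n \<le> i" for i
    unfolding low_def using that by (auto simp: coeff_sum intro!: sum.neutral coeff_eq_0)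
  have "coeff (falling_sum n a) n = 1"
    using low[of n] lead_coeff_falling[of n] by (simp add: sum)
  moreover have "degree (falling_sum n a) \<le> n"
    using low by (intro degree_le) (simp add: sum coeff_eq_0)
  ultimately show "degree (falling_sum n a) = n" and "lead_coeff (falling_sum n a) = 1"
    by (metis le_antisym le_degree zero_neq_one)+
qed

text \<open>
  The basis element with index \<open>k\<close> satisfies \<open>x \<cdot> falling k = k \<cdot> falling k + falling (k + 1)\<close>, so a
  three-term relation between polynomials can be read off from their coefficients. The last
  coefficient of \<open>b\<close> vanishes to leave room for the degree that the factor \<open>x\<close> adds.
\<close>
lemma falling_sum_recurrence:
  assumes rec: "\<And>k. k \<le> Suc M \<Longrightarrow>
      a k = (real k - t) * b k + (if k = 0 then 0 else b (k - 1)) - u * c k"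
    and top: "b (Suc M) = 0"
  shows "falling_sum (Suc M) a =
      [:- t, 1:] * falling_sum (Suc M) b - smult u (falling_sum (Suc M) c)"
proof -
  have shift: "[:- t, 1:] * falling k = smult (real k - t) (falling k) + falling (Suc k)" for k
    by (simp add: falling_Suc smult_diff_left)
  have "(\<Sum>k\<le>Suc M. smult (if k = 0 then 0 else b (k - 1)) (falling k))
      = (\<Sum>k\<le>M. smult (b k) (falling (Suc k)))"
    by (subst sum.atMost_Suc_shift) simp
  also have "\<dots> = (\<Sum>k\<le>Suc M. smult (b k) (falling (Suc k)))"
    using top by simp
  finally have raise: "(\<Sum>k\<le>Suc M. smult (if k = 0 then 0 else b (k - 1)) (falling k))
      = (\<Sum>k\<le>Suc M. smult (b k) (falling (Suc k)))" .
  have "falling_sum (Suc M) a =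
      (\<Sum>k\<le>Suc M. smult ((real k - t) * b k + (if k = 0 then 0 else b (k - 1)) - u * c k) (falling k))"
    unfolding falling_sum_def using rec by (intro sum.cong) auto
  also have "\<dots> = (\<Sum>k\<le>Suc M. smult ((real k - t) * b k) (falling k))
      + (\<Sum>k\<le>Suc M. smult (if k = 0 then 0 else b (k - 1)) (falling k))
      - (\<Sum>k\<le>Suc M. smult (u * c k) (falling k))"
    by (simp only: smult_add_left smult_diff_left sum.distrib sum_subtractf)
  also have "(\<Sum>k\<le>Suc M. smult (u * c k) (falling k)) = smult u (falling_sum (Suc M) c)"
    unfolding falling_sum_smult[symmetric] by (simp only: falling_sum_def)
  also have "(\<Sum>k\<le>Suc M. smult ((real k - t) * b k) (falling k))
      + (\<Sum>k\<le>Suc M. smult (if k = 0 then 0 else b (k - 1)) (falling k))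
      = [:- t, 1:] * falling_sum (Suc M) b"
    unfolding raise falling_sum_def sum_distrib_left mult_smult_right shift
    by (simp only: smult_add_right smult_smult sum.distrib mult.commute)
  finally show ?thesis .
qed

text \<open>
  Newton's expansion of the derivative, \<open>d/dx = \<Sum>\<^sub>i (-1)\<^sup>i\<^sup>-\<^sup>1 \<Delta>\<^sup>i / i\<close>. The product rule
  for \<open>falling (n + 1) = (x - n) \<cdot> falling n\<close> is a recurrence of the above kind, with the
  coefficients of \<open>falling n\<close> itself as the last term, and this proves it by induction.
\<close>
lemma pderiv_falling:
  "pderiv (falling n) = falling_sum n
     (\<lambda>k. if k < n then (-1) ^ (n - k - 1) * fact n / (fact k * real (n - k)) else 0)"
proof (induction n)
  case 0
  then show ?case by (simp add: falling_sum_def)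
next
  case (Suc n)
  define D where "D n k = (if k < n then (-1) ^ (n - k - 1) * fact n / (fact k * real (n - k)) else 0)"
    for n k :: nat
  have coeffs: "D (Suc n) k = (real k - real n) * D n k + (if k = 0 then 0 else D n (k - 1))
      - (- 1) * (if k = n then 1 else 0)" for k
  proof (cases k n rule: linorder_cases)
    case less
    then obtain d where n: "n = Suc (k + d)"
      using less_iff_Suc_add by auto
    show ?thesis
    proof (cases k)
      case 0
      then show ?thesis using n by (simp add: D_def divide_simps) (simp add: algebra_simps)
    next
      case (Suc j)
      then show ?thesis using n by (simp add: D_def divide_simps) (simp add: algebra_simps)
    qed
  next
    case equal
    then show ?thesis by (cases n) (simp_all add: D_def divide_simps)
  next
    case greater
    then show ?thesis by (auto simp: D_def)
  qed
  have "falling_sum (Suc n) (D (Suc n)) = [:- real n, 1:] * falling_sum (Suc n) (D n)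
      - smult (- 1) (falling_sum (Suc n) (\<lambda>k. if k = n then 1 else 0))"
    by (rule falling_sum_recurrence) (use coeffs in \<open>auto simp: D_def\<close>)
  also have "falling_sum (Suc n) (D n) = falling_sum n (D n)"
    by (rule falling_sum_extend) (auto simp: D_def)
  also have "\<dots> = pderiv (falling n)"
    unfolding D_def by (rule Suc[symmetric])
  also have "falling_sum (Suc n) (\<lambda>k. if k = n then 1 else 0) = falling n"
    by (rule falling_sum_delta) simp
  also have "[:- real n, 1:] * pderiv (falling n) - smult (- 1) (falling n) = pderiv (falling (Suc n))"
    unfolding falling_Suc pderiv_mult by (simp add: pderiv_pCons)
  finally show ?case
    unfolding D_def by (rule sym)
qed

section \<open>Coefficients of the Hahn polynomials\<close>

text \<open>
  The coefficient of \<open>falling k\<close> in \<open>H\<^sub>n\<close> for \<open>n = k + d\<close> and \<open>N = n + m\<close>. With these differences as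
  arguments no truncated subtraction occurs, and neighbouring coefficients differ by successor steps.
\<close>
definition hahn_coeff :: "nat \<Rightarrow> nat \<Rightarrow> nat \<Rightarrow> real" where
  "hahn_coeff k d m = (-1) ^ d * fact (k + d) / (fact k * fact d) *
     ((fact (d + m))\<^sup>2 * fact (2 * m + 1) / ((fact m)\<^sup>2 * fact (2 * m + 1 + d)))"

lemma hahn_coeff_top [simp]: "hahn_coeff k 0 m = 1"
  by (simp add: hahn_coeff_def)

text \<open>
  The ratios between neighbouring coefficients for fixed \<open>N\<close>: the next lemma relates the degrees
  \<open>n + 1\<close> and \<open>n\<close> at a common index \<open>k\<close>, the one after it the indices \<open>k - 1\<close> and \<open>k\<close> in a common
  degree.
\<close>
lemma hahn_coeff_degree_up:
  "hahn_coeff k (Suc e) m = - hahn_coeff k e (Suc m) *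
     ((real k + real e + 1) * (real m + 1) * (2 * real m + 3 + real e) /
      (2 * (real e + 1) * (2 * real m + 3)))"
proof -
  have p: "2 * real m + 3 \<noteq> 0" "2 * real m + 3 + real e \<noteq> 0" "1 + real m \<noteq> 0"
    by linarith+
  show ?thesis unfolding hahn_coeff_def using p
  by (simp add: divide_simps, simp add: algebra_simps power2_eq_square)
qed

lemma hahn_coeff_index_down:
  "hahn_coeff j (Suc e) m = - hahn_coeff (Suc j) e m *
     ((real j + 1) * (real e + real m + 1)\<^sup>2 / ((real e + 1) * (2 * real m + 2 + real e)))"
  unfolding hahn_coeff_def
  by (simp add: divide_simps, simp add: algebra_simps power2_eq_square)

text \<open>
  The three-term recurrence at index \<open>k\<close> with \<open>n = k + e\<close> and \<open>N = n + m\<close>, divided by the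
  \<open>k\<close>-th coefficient of \<open>H\<^sub>n\<close>. Each of the boundary cases \<open>m = 0\<close>, \<open>k = 0\<close> and \<open>e = 0\<close> removes exactly
  the term whose coefficient is missing there, so a single identity covers them all.
\<close>
lemma ratio_identity:
  fixes k e m :: real
  assumes "0 \<le> e" "0 \<le> m"
  shows "- ((k + e + 1) * m * (2 * m + 1 + e) / (2 * (e + 1) * (2 * m + 1))) =
    (k - (k + e + m) / 2) + - (k * (e + m + 1)\<^sup>2 / ((e + 1) * (2 * m + 2 + e)))
    - - (e * (m + 1) * (k + e + 2 * m + 2) / (2 * (2 * m + 1) * (2 * m + 2 + e)))"
proof -
  have "e + 1 \<noteq> 0" "2 * m + 1 \<noteq> 0" "2 * m + 2 + e \<noteq> 0" using assms by linarith+
  then show ?thesis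
    by (simp add: divide_simps) (simp add: algebra_simps power2_eq_square)
qed

section \<open>The three-term recurrence\<close>

text \<open>The recurrence coefficient \<open>u\<^sub>n\<close>, as a function of \<open>n\<close> and \<open>m = N - n\<close>.\<close>
definition hahn_u :: "nat \<Rightarrow> nat \<Rightarrow> real" where
  "hahn_u n m = real n * (real m + 1)\<^sup>2 * (real n + 2 * real m + 2) /
     (4 * (2 * real m + 1) * (2 * real m + 3))"

lemma hahn_u_pos: "0 < n \<Longrightarrow> 0 < hahn_u n m"
  by (simp add: hahn_u_def add_nonneg_pos)

text \<open>
  All coefficients of \<open>H\<^sub>n\<close>, continued beyond \<open>n = N\<close> by those of the falling factorial; with this
  continuation the recurrence also holds at \<open>n = N\<close>, where the hypergeometric formula for \<open>H\<^sub>n\<^sub>+\<^sub>1\<close>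
  would divide by zero.
\<close>
definition hahn_row :: "nat \<Rightarrow> nat \<Rightarrow> nat \<Rightarrow> real" where
  "hahn_row N n k =
     (if n \<le> N then if k \<le> n then hahn_coeff k (n - k) (N - n) else 0
      else if k = n then 1 else 0)"

text \<open>
  Each of the other three coefficients is a rational multiple of the coefficient \<open>y\<close> of \<open>H\<^sub>n\<close> at index
  \<open>k\<close>, and the multiples add up by \<open>ratio_identity\<close>. Only the index \<open>k = n + 1\<close>, where \<open>y\<close> vanishes,
  stands apart: there the relation compares leading coefficients.
\<close>
lemma hahn_row_recurrence:
  assumes n: "1 \<le> n" "n \<le> N"
  shows "hahn_row N (n + 1) k = (real k - real N / 2) * hahn_row N n k
    + (if k = 0 then 0 else hahn_row N n (k - 1)) - hahn_u n (N - n) * hahn_row N (n - 1) k"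
proof (cases "k \<le> n")
  case False
  with n show ?thesis by (cases "k = n + 1") (auto simp: hahn_row_def)
next
  case True
  define e m where "e = n - k" and "m = N - n"
  define y where "y = hahn_coeff k e m"
  have n_eq: "n = k + e" and N_eq: "N = k + e + m"
    using True n by (auto simp: e_def m_def)
  have mid: "hahn_row N n k = y"
    using True n by (simp add: hahn_row_def y_def e_def m_def)
  have up: "hahn_row N (n + 1) k = y * - ((real k + real e + 1) * real m * (2 * real m + 1 + real e) /
      (2 * (real e + 1) * (2 * real m + 1)))"
  proof (cases m)
    case 0
    then show ?thesis by (simp add: hahn_row_def n_eq N_eq)
  next
    case (Suc m')
    have row: "hahn_row N (n + 1) k = hahn_coeff k (Suc e) m'"
      using Suc by (simp add: hahn_row_def n_eq N_eq Suc_diff_le)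
    have shift: "2 * real (Suc m') + 1 = 2 * real m' + 3" "real (Suc m') = real m' + 1"
      by simp_all
    show ?thesis
      unfolding row hahn_coeff_degree_up y_def Suc shift by (simp add: add_ac)
  qed
  have left: "(if k = 0 then 0 else hahn_row N n (k - 1)) =
      y * - (real k * (real e + real m + 1)\<^sup>2 / ((real e + 1) * (2 * real m + 2 + real e)))"
  proof (cases k)
    case 0
    then show ?thesis by simp
  next
    case (Suc j)
    then show ?thesis
      using hahn_coeff_index_down[of j e m] by (simp add: hahn_row_def n_eq N_eq y_def add_ac)
  qed
  have down: "hahn_u n m * hahn_row N (n - 1) k =
      y * - (real e * (real m + 1) * (real k + real e + 2 * real m + 2) /
        (2 * (2 * real m + 1) * (2 * real m + 2 + real e)))"
  proof (cases e)
    case 0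
    then show ?thesis using n by (simp add: hahn_row_def n_eq N_eq)
  next
    case (Suc e')
    have row: "hahn_row N (n - 1) k = hahn_coeff k e' (Suc m)"
      using Suc by (simp add: hahn_row_def n_eq N_eq)
    have nz: "2 * real m + 1 \<noteq> 0" "2 * real m + 3 \<noteq> 0" "2 * real m + 3 + real e' \<noteq> 0"
      by linarith+
    show ?thesis
      unfolding row y_def Suc hahn_coeff_degree_up hahn_u_def using nz
      by (simp add: n_eq Suc divide_simps) (simp add: algebra_simps power2_eq_square)
  qed
  have "hahn_row N (n + 1) k = y * (real k - real N / 2)
      + y * - (real k * (real e + real m + 1)\<^sup>2 / ((real e + 1) * (2 * real m + 2 + real e)))
      - y * - (real e * (real m + 1) * (real k + real e + 2 * real m + 2) /
        (2 * (2 * real m + 1) * (2 * real m + 2 + real e)))"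
    unfolding up ratio_identity[where k = "real k" and e = "real e" and m = "real m",
        OF of_nat_0_le_iff of_nat_0_le_iff]
    by (simp only: N_eq of_nat_add distrib_left[of y] right_diff_distrib[of y])
  then show ?thesis
    unfolding mid left down m_def[symmetric] by (simp only: mult.commute)
qed

definition hahn_poly :: "nat \<Rightarrow> nat \<Rightarrow> real poly" where
  "hahn_poly N n = falling_sum n (hahn_row N n)"

lemma hahn_poly_recurrence:
  assumes n: "1 \<le> n" "n \<le> N"
  shows "hahn_poly N (n + 1) =
    [:- (real N / 2), 1:] * hahn_poly N n - smult (hahn_u n (N - n)) (hahn_poly N (n - 1))"
proof -
  have "falling_sum (Suc n) (hahn_row N (n + 1)) =
      [:- (real N / 2), 1:] * falling_sum (Suc n) (hahn_row N n)
      - smult (hahn_u n (N - n)) (falling_sum (Suc n) (hahn_row N (n - 1)))"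
    by (rule falling_sum_recurrence)
      (use hahn_row_recurrence[OF n] n in \<open>auto simp: hahn_row_def\<close>)
  moreover have "falling_sum (Suc n) (hahn_row N n) = falling_sum n (hahn_row N n)"
    by (rule falling_sum_extend) (auto simp: hahn_row_def)
  moreover have "falling_sum (Suc n) (hahn_row N (n - 1)) = falling_sum (n - 1) (hahn_row N (n - 1))"
    using n by (intro falling_sum_extend) (auto simp: hahn_row_def)
  ultimately show ?thesis
    unfolding hahn_poly_def by (simp only: Suc_eq_plus1)
qed

section \<open>The Hahn polynomials form the Sturmian sequence\<close>
lemma hahn_poly_top: "hahn_poly N (N + 1) = falling (N + 1)"
proof -
  have "hahn_row N (N + 1) = (\<lambda>k. if k = N + 1 then 1 else 0)"
    by (auto simp: hahn_row_def)
  then show ?thesis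
    unfolding hahn_poly_def by (simp only: falling_sum_delta[OF order_refl])
qed

text \<open>
  In degree \<open>N\<close> the factorials cancel: \<open>(d!)\<^sup>2 / (d + 1)! = d! / (d + 1)\<close>, which leaves the denominators
  of the logarithmic series that \<open>pderiv_falling\<close> produces.
\<close>
lemma hahn_poly_eq_pderiv:
  "hahn_poly N N = smult (1 / (real N + 1)) (pderiv (falling (N + 1)))"
proof -
  have "hahn_row N N k = 1 / (real N + 1) * ((-1) ^ (N - k) * fact (N + 1) / (fact k * real (N + 1 - k)))"
    if "k \<le> N" for k
  proof -
    obtain d where "N = k + d"
      using \<open>k \<le> N\<close> le_Suc_ex by blast
    then show ?thesis
      by (simp add: hahn_row_def hahn_coeff_def divide_simps) (simp add: algebra_simps power2_eq_square)
  qed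
  then have "hahn_poly N N = falling_sum N (\<lambda>k. 1 / (real N + 1) *
      (if k < N + 1 then (-1) ^ (N + 1 - k - 1) * fact (N + 1) / (fact k * real (N + 1 - k)) else 0))"
    unfolding hahn_poly_def by (intro falling_sum_cong) simp
  also have "\<dots> = smult (1 / (real N + 1)) (falling_sum N (\<lambda>k.
      if k < N + 1 then (-1) ^ (N + 1 - k - 1) * fact (N + 1) / (fact k * real (N + 1 - k)) else 0))"
    by (rule falling_sum_smult)
  also have "\<dots> = smult (1 / (real N + 1)) (falling_sum (N + 1) (\<lambda>k.
      if k < N + 1 then (-1) ^ (N + 1 - k - 1) * fact (N + 1) / (fact k * real (N + 1 - k)) else 0))"
    by (subst falling_sum_extend[of N "N + 1"]) auto
  finally show ?thesis
    by (simp only: pderiv_falling)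
qed

lemma is_sturmian_hahn_poly:
  assumes "1 \<le> N"
  shows "is_sturmian N real (hahn_poly N)"
  unfolding is_sturmian_def
proof (intro conjI)
  show "hahn_poly N (N + 1) = (\<Prod>s\<le>N. [:- real s, 1:])"
    unfolding hahn_poly_top by (simp add: falling_def lessThan_Suc_atMost)
  show "hahn_poly N N = smult (1 / (real N + 1)) (pderiv (hahn_poly N (N + 1)))"
    unfolding hahn_poly_top by (rule hahn_poly_eq_pderiv)
  show "hahn_poly N 0 = 1"
    by (simp add: hahn_poly_def falling_sum_def hahn_row_def)
  show "\<forall>n\<le>N. degree (hahn_poly N n) = n \<and> lead_coeff (hahn_poly N n) = 1"
    unfolding hahn_poly_def by (auto simp: hahn_row_def intro!: falling_sum_monic)
  \<comment> \<open>The constant term of \<open>P\<^sub>1\<close> must be \<open>- b\<^sub>0\<close> with the same \<open>b\<^sub>0 = N / 2\<close> as in higher degrees.\<close>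
  have "hahn_coeff 0 1 (N - 1) = - (real N / 2)"
  proof -
    obtain m where N: "N = Suc m" using assms by (cases N) auto
    have nz: "2 * real m + 3 \<noteq> 0" by linarith
    show ?thesis
      unfolding N One_nat_def hahn_coeff_degree_up using nz
      by (simp add: divide_simps) (simp add: algebra_simps)
  qed
  then have "hahn_poly N 1 = [:- (real N / 2), 1:]"
    using assms by (simp add: hahn_poly_def falling_sum_def hahn_row_def falling_Suc)
  then show "\<exists>b u. hahn_poly N 1 = [:- b 0, 1:] \<and>
      (\<forall>n\<in>{1..N}. u n > (0::real) \<and>
        hahn_poly N (n + 1) = [:- b n, 1:] * hahn_poly N n - smult (u n) (hahn_poly N (n - 1)))"
    using hahn_poly_recurrence hahn_u_pos
    by (intro exI[of _ "\<lambda>_. real N / 2"] exI[of _ "\<lambda>n. hahn_u n (N - n)"]) auto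
qed

section \<open>Comparison with the hypergeometric series\<close>

text \<open>
  All parameters of the hypergeometric series except \<open>-x\<close> are negative integers \<open>- m\<close>, whose
  Pochhammer symbols are quotients of factorials.
\<close>
lemma pochhammer_neg_nat:
  assumes "k \<le> m"
  shows "pochhammer (- real m) k = (-1) ^ k * fact m / fact (m - k)"
proof -
  have "real (m choose k) = (-1) ^ k * pochhammer (- real m) k / fact k"
    by (simp add: binomial_gbinomial gbinomial_pochhammer)
  then show ?thesis
    using binomial_fact[OF assms, where 'a = real]
    by (simp add: field_simps)
qed

text \<open>
  The parameter \<open>n + \<alpha> + \<beta> + 1\<close> equals \<open>- (2 N + 1 - n)\<close>. As \<open>k \<le> n \<le> N\<close> and
  \<open>n < 2 N + 1 - n\<close>, neither \<open>(- N)\<^sub>k\<close> nor the denominator of \<open>\<kappa>\<^sub>n\<close> vanishes.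
\<close>
lemma hahn_eq_poly_hahn_poly:
  assumes n: "n \<le> N"
  shows "hahn n (- real N - 1) (- real N - 1) N x = poly (hahn_poly N n) x"
proof -
  define M where "M = 2 * N + 1 - n"
  have M: "real n + (- real N - 1) + (- real N - 1) + 1 = - real M"
    using n by (simp add: M_def)
  have term_eq: "pochhammer (- real N) n * pochhammer (- real N) n / pochhammer (- real M) n *
      (pochhammer (- real n) k * pochhammer (- x) k * pochhammer (- real M) k /
        (pochhammer (- real N) k * pochhammer (- real N) k) * 1 ^ k / fact k) =
      hahn_row N n k * poly (falling k) x" if k: "k \<le> n" for k
  proof -
    define d m where "d = n - k" and "m = N - n"
    have n_eq: "n = k + d" and N_eq: "N = k + d + m" and M_eq: "M = k + d + 2 * m + 1"
      using n k by (auto simp: d_def m_def M_def)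
    have poch:
      "pochhammer (- real N) n = (- 1) ^ (k + d) * fact (k + d + m) / fact m"
      "pochhammer (- real M) n = (- 1) ^ (k + d) * fact (k + d + 2 * m + 1) / fact (2 * m + 1)"
      "pochhammer (- real n) k = (- 1) ^ k * fact (k + d) / fact d"
      "pochhammer (- real M) k = (- 1) ^ k * fact (k + d + 2 * m + 1) / fact (2 * m + 1 + d)"
      "pochhammer (- real N) k = (- 1) ^ k * fact (k + d + m) / fact (d + m)"
      using pochhammer_neg_nat[of n N] pochhammer_neg_nat[of n M] pochhammer_neg_nat[of k n]
        pochhammer_neg_nat[of k M] pochhammer_neg_nat[of k N]
      unfolding n_eq N_eq M_eq by (simp_all add: add_ac del: fact_Suc)
    have row: "hahn_row N n k = hahn_coeff k d m"
      using n k by (simp add: hahn_row_def d_def m_def)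
    have sign: "(-1) ^ k * (-1) ^ k = (1 :: real)"
      by (simp flip: power_mult_distrib)
    show ?thesis
      unfolding poch row hahn_coeff_def poly_falling power_add using sign
      by (simp add: divide_simps power2_eq_square mult_ac del: fact_Suc)
  qed
  have "hahn n (- real N - 1) (- real N - 1) N x =
      (\<Sum>k\<le>n. hahn_row N n k * poly (falling k) x)"
    unfolding hahn_def hyp_3F2_partial_def M sum_distrib_left atLeast0AtMost
    using term_eq by (intro sum.cong) simp_all
  also have "\<dots> = poly (hahn_poly N n) x"
    by (simp add: hahn_poly_def falling_sum_def poly_sum)
  finally show ?thesis .
qed

theorem proposition2:
  fixes N :: nat
  assumes "N \<ge> 1"
  shows "\<forall>n\<le>N. \<forall>x::real.
           poly (sturmian N (\<lambda>s. real s) n) x = hahn n (- real N - 1) (- real N - 1) N x"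
  using is_sturmian_imp_eq_sturmian[OF is_sturmian_hahn_poly[OF assms]]
  by (auto simp: hahn_eq_poly_hahn_poly)

end
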